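(* Let $p,q,r$ be distinct primes and let $G$ be a group of order $pq$, $p^2q$, or $pqr$. Then the difference graph $D(G)$ is perfect.
   Context: For a group $G$, the power graph $\mathsf{Pow}(G)$ has vertex set $G$, with distinct $a,b$ adjacent iff $a\in\langle b\rangle$ or $b\in\langle a\rangle$. The enhanced power graph $\mathsf{EPow}(G)$ has vertex set $G$, with distinct $a,b$ adjacent iff $\langle a,b\rangle$ is cyclic. The difference graph $D(G)$ is the graph $\mathsf{EPow}(G)-\mathsf{Pow}(G)$ with all isolated vertices removed; thus $x\sim y$ in $D(G)$ iff $\langle x,y\rangle$ is cyclic, $x\notin\langle y\rangle$ and $y\notin\langle x\rangle$. *)

theory Defs
  imports
    "HOL-Algebra.Elementary_Groups"
    "HOL-Computational_Algebra.Primes"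
    "Graph_Theory.Digraph_Component"
    "Graph_Theory.Pair_Digraph"
begin

text \<open>As in the Graph_Theory entry, a simple undirected graph is a symmetric loop-free digraph:
  an edge joining a and b is the pair of arcs (a, b) and (b, a).\<close>

definition power_graph :: "('a, 'b) monoid_scheme \<Rightarrow> 'a pair_pre_digraph" where
  "power_graph G = \<lparr> pverts = carrier G,
     parcs = {(a, b). a \<in> carrier G \<and> b \<in> carrier G \<and> a \<noteq> b \<and>
                      (a \<in> generate G {b} \<or> b \<in> generate G {a})} \<rparr>"

definition enhanced_power_graph :: "('a, 'b) monoid_scheme \<Rightarrow> 'a pair_pre_digraph" where
  "enhanced_power_graph G = \<lparr> pverts = carrier G,
     parcs = {(a, b). a \<in> carrier G \<and> b \<in> carrier G \<and> a \<noteq> b \<and>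
                      cyclic_group (subgroup_generated G {a, b})} \<rparr>"

definition delete_edges :: "'a pair_pre_digraph \<Rightarrow> 'a pair_pre_digraph \<Rightarrow> 'a pair_pre_digraph" where
  "delete_edges X Y = \<lparr> pverts = pverts X, parcs = parcs X - parcs Y \<rparr>"

definition remove_isolated :: "'a pair_pre_digraph \<Rightarrow> 'a pair_pre_digraph" where
  "remove_isolated X =
     \<lparr> pverts = {v \<in> pverts X. \<exists>w. (v, w) \<in> parcs X \<or> (w, v) \<in> parcs X}, parcs = parcs X \<rparr>"

definition difference_graph :: "('a, 'b) monoid_scheme \<Rightarrow> 'a pair_pre_digraph" where
  "difference_graph G = remove_isolated (delete_edges (enhanced_power_graph G) (power_graph G))"

definition proper_colouring :: "('a, 'b) pre_digraph \<Rightarrow> nat \<Rightarrow> ('a \<Rightarrow> nat) \<Rightarrow> bool" where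
  "proper_colouring X k c \<longleftrightarrow>
     (\<forall>v \<in> verts X. c v < k) \<and> (\<forall>(u, v) \<in> arcs_ends X. c u \<noteq> c v)"

definition chromatic_number :: "('a, 'b) pre_digraph \<Rightarrow> nat" where
  "chromatic_number X = (LEAST k. \<exists>c. proper_colouring X k c)"

definition clique :: "('a, 'b) pre_digraph \<Rightarrow> 'a set \<Rightarrow> bool" where
  "clique X K \<longleftrightarrow> K \<subseteq> verts X \<and> (\<forall>u \<in> K. \<forall>v \<in> K. u \<noteq> v \<longrightarrow> (u, v) \<in> arcs_ends X)"

definition clique_number :: "('a, 'b) pre_digraph \<Rightarrow> nat" where
  "clique_number X = Max (card ` {K. clique X K})"

text \<open>The locale predicate \<^term>\<open>graph\<close> (finite, simple, symmetric) guarantees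
  that the minimum and the maximum above exist. The null graph is perfect, both numbers being 0.\<close>

definition perfect_graph :: "('a, 'b) pre_digraph \<Rightarrow> bool" where
  "perfect_graph X \<longleftrightarrow>
     graph X \<and> (\<forall>H. induced_subgraph H X \<longrightarrow> chromatic_number H = clique_number H)"

end

theory Submission
  imports Defs "HOL-Algebra.Multiplicative_Group"
begin

text \<open>Two elements are adjacent in the difference graph iff they lie in a common cyclic subgroup and
  their orders are incomparable under divisibility. For order p^k q, colouring x by whether q
  divides its order is proper, so the graph is bipartite. For order pqr only the sets of primes
  dividing the orders matter. If the group is cyclic, every induced subgraph is a blow-up of an
  induced subgraph of the incomparability graph of the subsets of a three-element set. If it is
  not cyclic, only elements of distinct prime orders are adjacent. An element of order r adjacent
  to elements of orders p and q has centralizer G, so it is central, and then no elements of orders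
  p and q commute, since otherwise G would be cyclic. Hence the graph is bipartite.\<close>

section \<open>Perfect graphs\<close>

text \<open>A proper colouring is injective on every clique, so no clique has more vertices than any
  proper colouring has colours. A clique and a colouring of the same size therefore pin both
  numbers.\<close>

lemma chromatic_eq_cliqueI:
  assumes fin: "finite (verts X)" and col: "proper_colouring X k c"
    and K: "clique X K" and card: "card K = k"
  shows "chromatic_number X = clique_number X"
proof -
  have clique_le: "card L \<le> l" if "clique X L" "proper_colouring X l d" for L l d
  proof -
    have "inj_on d L" "d ` L \<subseteq> {..<l}"
      using that unfolding clique_def proper_colouring_def inj_on_def by blast+
    then show ?thesis
      by (metis card_image card_lessThan card_mono finite_lessThan)
  qed
  have "chromatic_number X = k"
    unfolding chromatic_number_def
    using col clique_le[OF K] card by (intro Least_equality) auto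
  moreover have "clique_number X = k"
    unfolding clique_number_def
  proof (rule Max_eqI)
    have "{L. clique X L} \<subseteq> Pow (verts X)"
      by (auto simp: clique_def)
    then show "finite (card ` {L. clique X L})"
      using fin by (meson finite_Pow_iff finite_imageI finite_subset)
  qed (use K card clique_le[OF _ col] in auto)
  ultimately show ?thesis by simp
qed

text \<open>The common value is 2, 1 or 0, witnessed by an edge, a single vertex or the empty
  clique, according to whether the graph has an edge, has vertices but no edge, or is null.\<close>

lemma chromatic_eq_clique_bipartite:
  fixes c :: "'a \<Rightarrow> bool"
  assumes "graph X" and c: "\<And>u v. (u, v) \<in> arcs_ends X \<Longrightarrow> c u \<noteq> c v"
  shows "chromatic_number X = clique_number X"
proof -
  interpret graph X by fact
  consider (arc) u v where "(u, v) \<in> arcs_ends X"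
    | (vertex) u where "u \<in> verts X" "arcs_ends X = {}"
    | (null) "verts X = {}" "arcs_ends X = {}"
    by (metis ex_in_conv surj_pair)
  then show ?thesis
  proof cases
    case arc
    then have "(v, u) \<in> arcs_ends X" "u \<in> verts X" "v \<in> verts X"
      using arcs_ends_symmetric[OF sym_arcs] by (auto simp: arcs_ends_conv)
    with arc have "clique X {u, v}"
      by (auto simp: clique_def)
    moreover have "card {u, v} = 2"
      using c[OF arc] by (auto simp: card_insert_if)
    moreover have "proper_colouring X 2 (\<lambda>v. if c v then 1 else 0)"
      using c by (auto simp: proper_colouring_def)
    ultimately show ?thesis
      by (intro chromatic_eq_cliqueI) auto
  next
    case vertex
    then show ?thesis
      by (intro chromatic_eq_cliqueI[of X 1 "\<lambda>_. 0" "{u}"])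
        (auto simp: proper_colouring_def clique_def)
  next
    case null
    then show ?thesis
      by (intro chromatic_eq_cliqueI[of X 0 "\<lambda>_. 0" "{}"])
        (auto simp: proper_colouring_def clique_def)
  qed
qed

text \<open>Translates induced subgraphs into a condition on \<open>arcs_ends\<close>, so that later
  arguments deal only with an adjacency relation.\<close>

lemma perfect_graphI:
  fixes X :: "('a, 'b) pre_digraph"
  assumes "graph X"
    and "\<And>Y :: ('a, 'b) pre_digraph. \<lbrakk>graph Y; verts Y \<subseteq> verts X;
          \<And>u v. (u, v) \<in> arcs_ends Y \<longleftrightarrow> (u, v) \<in> arcs_ends X \<and> u \<in> verts Y \<and> v \<in> verts Y\<rbrakk>
        \<Longrightarrow> chromatic_number Y = clique_number Y"
  shows "perfect_graph X"
  unfolding perfect_graph_def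
proof (intro conjI allI impI)
  fix Y assume Y: "induced_subgraph Y X"
  interpret graph X by fact
  have "graph Y"
    using digraphI_induced[OF Y] induced_graph_imp_symmetric[OF sym_arcs Y]
    by (rule digraph.graphI)
  moreover have "verts Y \<subseteq> verts X"
    using Y by auto
  moreover have "(u, v) \<in> arcs_ends Y \<longleftrightarrow> (u, v) \<in> arcs_ends X \<and> u \<in> verts Y \<and> v \<in> verts Y" for u v
  proof -
    \<comment> \<open>Compatibility makes both digraphs share \<open>tail\<close> and
      \<open>head\<close>, so arcs can be compared by their ends.\<close>
    have "compatible X Y" using Y by auto
    then have eq: "tail X = tail Y" "head X = head Y"
      by (rule compatible_tail compatible_head)+
    have "arcs Y = {e \<in> arcs X. tail X e \<in> verts Y \<and> head X e \<in> verts Y}"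
      using Y unfolding induced_subgraph_def by (rule conjunct2)
    then have "e \<in> arcs Y \<longleftrightarrow> e \<in> arcs X \<and> tail Y e \<in> verts Y \<and> head Y e \<in> verts Y" for e
      unfolding eq by blast
    then show ?thesis
      unfolding arcs_ends_conv eq by blast
  qed
  ultimately show "chromatic_number Y = clique_number Y"
    by (rule assms(2))
qed fact

lemma perfect_graph_bipartite:
  fixes c :: "'a \<Rightarrow> bool"
  assumes "graph X" and "\<And>u v. (u, v) \<in> arcs_ends X \<Longrightarrow> c u \<noteq> c v"
  shows "perfect_graph X"
  by (intro perfect_graphI chromatic_eq_clique_bipartite[where c = c]) (use assms in blast)+

section \<open>Incomparability of subsets of a three-element set\<close>

text \<open>A vertex is read as the set of predicates true of it, and two such sets are compared
  under inclusion. Later the predicates are divisibility of the order by three primes.\<close>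

definition incomparable3 :: "('a \<Rightarrow> bool) \<Rightarrow> ('a \<Rightarrow> bool) \<Rightarrow> ('a \<Rightarrow> bool) \<Rightarrow> 'a \<Rightarrow> 'a \<Rightarrow> bool" where
  "incomparable3 P Q R u v \<longleftrightarrow>
     \<not> ((P u \<longrightarrow> P v) \<and> (Q u \<longrightarrow> Q v) \<and> (R u \<longrightarrow> R v)) \<and>
     \<not> ((P v \<longrightarrow> P u) \<and> (Q v \<longrightarrow> Q u) \<and> (R v \<longrightarrow> R u))"

text \<open>Either of the first two predicates can thus be moved into the last place, the one that
  \<open>incomparable3_two_colours\<close> singles out.\<close>

lemma incomparable3_swap:
  "incomparable3 P R Q = incomparable3 P Q R" "incomparable3 R Q P = incomparable3 P Q R"
  unfolding incomparable3_def fun_eq_iff by blast+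

text \<open>A vertex u stands for the subset of the three-element set {P, Q, R} of predicates true of u.
  Without the singleton {R} and one of the two-element subsets, the remaining four proper nonempty
  subsets split into two chains, which are the colour classes.\<close>

lemma incomparable3_two_colours:
  assumes no1: "\<not> (\<exists>u \<in> V. \<not> P u \<and> \<not> Q u \<and> R u)"
    and no2: "\<not> (\<exists>u \<in> V. P u \<and> Q u \<and> \<not> R u) \<or> \<not> (\<exists>u \<in> V. P u \<and> R u \<and> \<not> Q u)
      \<or> \<not> (\<exists>u \<in> V. R u \<and> Q u \<and> \<not> P u)"
  obtains c :: "'a \<Rightarrow> bool"
    where "\<And>u v. \<lbrakk>u \<in> V; v \<in> V; incomparable3 P Q R u v\<rbrakk> \<Longrightarrow> c u \<noteq> c v"
proof (cases "\<exists>u \<in> V. R u \<and> Q u \<and> \<not> P u")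
  case True
  \<comment> \<open>As {Q, R} occurs, {P, Q} or {P, R} is missing. The sets containing
    \<open>P\<close> then form a chain, and those without \<open>P\<close> are {Q} and {Q, R}. The
    empty and the full set are comparable to everything.\<close>
  with no2 have "(\<forall>u \<in> V. \<not> (P u \<and> Q u \<and> \<not> R u)) \<or> (\<forall>u \<in> V. \<not> (P u \<and> \<not> Q u \<and> R u))"
    by blast
  then show ?thesis
    by (intro that[of P]) (use no1 in \<open>unfold incomparable3_def, blast\<close>)
next
  case False
  \<comment> \<open>Here {Q, R} is missing, and the two chains are {Q}, {P, Q} and {P}, {P,
    R}.\<close>
  show ?thesis
    by (intro that[of "\<lambda>u. \<not> Q u"]) (use no1 False in \<open>unfold incomparable3_def, blast\<close>)
qed

text \<open>If all three singletons or all three two-element sets occur, they give a triangle, and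
  three colours always suffice. Otherwise a singleton and a two-element set are both missing, and
  the graph is bipartite.\<close>

lemma chromatic_eq_clique_incomparable3:
  assumes "graph X"
    and adj: "\<And>u v. (u, v) \<in> arcs_ends X \<longleftrightarrow> u \<in> verts X \<and> v \<in> verts X \<and> incomparable3 P Q R u v"
  shows "chromatic_number X = clique_number X"
proof -
  interpret graph X by fact
  \<comment> \<open>The colours are three chains covering all subsets: {P}, {P, Q}; then {Q}, {Q,
    R}; then {}, {R}, {P, R}, {P, Q, R}.\<close>
  let ?c = "\<lambda>u. if P u \<and> \<not> R u then 0 else if Q u \<and> \<not> P u then 1 else (2 :: nat)"
  have tri: ?thesis if "u \<in> verts X" "v \<in> verts X" "w \<in> verts X"
    "incomparable3 P Q R u v" "incomparable3 P Q R u w" "incomparable3 P Q R v w" for u v w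
  proof (rule chromatic_eq_cliqueI)
    have sym: "incomparable3 P Q R x y \<longleftrightarrow> incomparable3 P Q R y x" for x y
      unfolding incomparable3_def by blast
    show "clique X {u, v, w}"
      using that sym by (auto simp: clique_def adj)
    have "u \<noteq> v" "u \<noteq> w" "v \<noteq> w"
      using that unfolding incomparable3_def by blast+
    then show "card {u, v, w} = 3" by simp
    have "?c x \<noteq> ?c y" if "incomparable3 P Q R x y" for x y
      using that unfolding incomparable3_def
      by (cases "P x"; cases "Q x"; cases "R x"; cases "P y"; cases "Q y"; cases "R y") simp_all
    then show "proper_colouring X 3 ?c"
      unfolding proper_colouring_def by (auto simp only: adj) simp_all
  qed simp
  have two: ?thesis if "\<And>u v. \<lbrakk>u \<in> verts X; v \<in> verts X; incomparable3 P Q R u v\<rbrakk> \<Longrightarrow> c u \<noteq> c v"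
    for c :: "'a \<Rightarrow> bool"
    using that adj by (intro chromatic_eq_clique_bipartite[OF \<open>graph X\<close>, of c]) auto
  let ?single = "\<lambda>A B C. \<exists>u \<in> verts X. \<not> A u \<and> \<not> B u \<and> C u"
  let ?pair = "\<lambda>A B C. \<exists>u \<in> verts X. A u \<and> B u \<and> \<not> C u"
  consider "?single P Q R" "?single P R Q" "?single R Q P"
    | "?pair P Q R" "?pair P R Q" "?pair R Q P"
    | "\<not> ?single P Q R" "\<not> ?pair P Q R \<or> \<not> ?pair P R Q \<or> \<not> ?pair R Q P"
    | "\<not> ?single P R Q" "\<not> ?pair P Q R \<or> \<not> ?pair P R Q \<or> \<not> ?pair R Q P"
    | "\<not> ?single R Q P" "\<not> ?pair P Q R \<or> \<not> ?pair P R Q \<or> \<not> ?pair R Q P"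
    by atomize_elim argo
  then show ?thesis
  proof cases
    case 1
    then obtain u v w where "u \<in> verts X" "v \<in> verts X" "w \<in> verts X"
      "\<not> P u \<and> \<not> Q u \<and> R u" "\<not> P v \<and> \<not> R v \<and> Q v" "\<not> R w \<and> \<not> Q w \<and> P w"
      by blast
    then show ?thesis
      by (intro tri[of u v w]) (simp_all add: incomparable3_def)
  next
    case 2
    then obtain u v w where "u \<in> verts X" "v \<in> verts X" "w \<in> verts X"
      "P u \<and> Q u \<and> \<not> R u" "P v \<and> R v \<and> \<not> Q v" "R w \<and> Q w \<and> \<not> P w"
      by blast
    then show ?thesis
      by (intro tri[of u v w]) (simp_all add: incomparable3_def)
  next
    case 3
    show ?thesis
      by (rule incomparable3_two_colours[OF 3]) (rule two)
  next
    case 4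
    \<comment> \<open>The missing singleton is {Q}, so \<open>Q\<close> and \<open>R\<close> trade
      places, and the condition on pairs is put into the matching form.\<close>
    then have "\<not> ?pair P R Q \<or> \<not> ?pair P Q R \<or> \<not> ?pair Q R P"
      by blast
    then show ?thesis
      by (rule incomparable3_two_colours[OF 4(1)]) (rule two, simp_all only: incomparable3_swap(1))
  next
    case 5
    then have "\<not> ?pair R Q P \<or> \<not> ?pair R P Q \<or> \<not> ?pair P Q R"
      by blast
    then show ?thesis
      by (rule incomparable3_two_colours[OF 5(1)]) (rule two, simp_all only: incomparable3_swap(2))
  qed
qed

section \<open>Orders and cyclic subgroups\<close>

text \<open>Both exponents are multiples of the gcd, and by Bezout the gcd is an integer combination
  of them.\<close>

lemma (in group) generate_int_pow_gcd:
  assumes z: "z \<in> carrier G"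
  shows "generate G {z [^] (i :: int), z [^] (j :: int)} = generate G {z [^] gcd i j}"
proof
  let ?u = "z [^] gcd i j"
  have u: "?u \<in> carrier G" using z by simp
  have "z [^] k \<in> generate G {?u}" if "gcd i j dvd k" for k
  proof -
    from that obtain m where "k = gcd i j * m" by (rule dvdE)
    then show ?thesis
      using z by (auto simp: generate_pow[OF u] int_pow_pow)
  qed
  then show "generate G {z [^] i, z [^] j} \<subseteq> generate G {?u}"
    using u by (intro generate_subgroup_incl generate_is_subgroup) auto
  obtain a b where "a * i + b * j = gcd i j"
    using bezout_int by blast
  then have u_eq: "?u = (z [^] i) [^] a \<otimes> (z [^] j) [^] b"
    using z by (simp add: int_pow_pow int_pow_mult[symmetric] mult.commute)
  have S: "subgroup (generate G {z [^] i, z [^] j}) G"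
    using z by (intro generate_is_subgroup) simp
  have "(z [^] i) [^] a \<in> generate G {z [^] i, z [^] j}"
    "(z [^] j) [^] b \<in> generate G {z [^] i, z [^] j}"
    by (rule subgroup_int_pow_closed[OF S], rule generate.incl, simp)+
  then have "?u \<in> generate G {z [^] i, z [^] j}"
    unfolding u_eq by (rule subgroup.m_closed[OF S])
  then show "generate G {?u} \<subseteq> generate G {z [^] i, z [^] j}"
    using S by (intro generate_subgroup_incl) auto
qed

text \<open>A generator of the subgroup serves as \<open>z\<close>. Conversely, \<open>x\<close> and
  \<open>y\<close> are powers of \<open>z\<close>, and together they generate the same subgroup as
  the power of \<open>z\<close> to the gcd of their exponents.\<close>

lemma (in group) cyclic_subgroup_generated_pair_iff:
  assumes xy: "x \<in> carrier G" "y \<in> carrier G"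
  shows "cyclic_group (subgroup_generated G {x, y}) \<longleftrightarrow>
    (\<exists>z \<in> carrier G. x \<in> generate G {z} \<and> y \<in> generate G {z})"
proof
  let ?S = "subgroup_generated G {x, y}"
  interpret S: group ?S by simp
  assume "cyclic_group ?S"
  then obtain z where z: "z \<in> carrier ?S" "carrier ?S = range (\<lambda>n::int. z [^]\<^bsub>?S\<^esub> n)"
    using S.cyclic_group by auto
  have "z \<in> carrier G"
    using z(1) carrier_subgroup_generated_subset by blast
  then have "carrier ?S = generate G {z}"
    using z(2) unfolding int_pow_subgroup_generated[OF z(1)] generate_pow[OF \<open>z \<in> carrier G\<close>]
    by (simp add: full_SetCompr_eq)
  moreover have "x \<in> carrier ?S" "y \<in> carrier ?S"
    using xy by (auto simp: carrier_subgroup_generated intro: generate.incl)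
  ultimately show "\<exists>z \<in> carrier G. x \<in> generate G {z} \<and> y \<in> generate G {z}"
    using \<open>z \<in> carrier G\<close> by blast
next
  assume "\<exists>z \<in> carrier G. x \<in> generate G {z} \<and> y \<in> generate G {z}"
  then obtain z i j where z: "z \<in> carrier G" "x = z [^] (i :: int)" "y = z [^] (j :: int)"
    by (auto simp: generate_pow)
  then have "generate G (carrier G \<inter> {x, y}) = generate G (carrier G \<inter> {z [^] gcd i j})"
    using generate_int_pow_gcd by simp
  then have "subgroup_generated G {x, y} = subgroup_generated G {z [^] gcd i j}"
    by (simp add: subgroup_generated_def)
  then show "cyclic_group (subgroup_generated G {x, y})"
    by (simp add: cyclic_group_generated)
qed

lemma (in group) ord_dvd_ord_if_in_generate:
  assumes "y \<in> carrier G" "x \<in> generate G {y}"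
  shows "ord x dvd ord y"
proof -
  obtain k :: int where "x = y [^] k"
    using assms by (auto simp: generate_pow)
  then have "x [^] ord y = \<one>"
    using assms(1) by (metis int_pow_int int_pow_one int_pow_pow mult.commute pow_ord_eq_1)
  then show ?thesis
    using assms pow_eq_id generate_in_carrier[of "{y}"] by auto
qed

text \<open>A finite cyclic group has only one subgroup of each order, so inside it the orders
  decide membership. The proof is explicit: \<open>z [^] m\<close> has order
  \<open>ord z div gcd (ord z) m\<close>, so divisibility of orders reverses to divisibility of the
  gcds.\<close>

lemma (in group) in_generate_iff_ord_dvd:
  assumes fin: "finite (carrier G)" and z: "z \<in> carrier G"
    and x: "x \<in> generate G {z}" and y: "y \<in> generate G {z}"
  shows "x \<in> generate G {y} \<longleftrightarrow> ord x dvd ord y"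
proof
  have yc: "y \<in> carrier G"
    using z y generate_in_carrier by blast
  then show "x \<in> generate G {y} \<Longrightarrow> ord x dvd ord y"
    by (rule ord_dvd_ord_if_in_generate)
  assume dvd: "ord x dvd ord y"
  obtain k l :: nat where k: "x = z [^] k" and l: "y = z [^] l"
    using x y z by (auto simp: generate_pow_on_finite_carrier[OF fin])
  have N: "ord z > 0"
    using ord_ge_1[OF fin z] by simp
  have o: "ord (z [^] m) = ord z div gcd (ord z) m" for m :: nat
    using z N by (simp add: ord_pow_gen)
  have "gcd (ord z) l dvd gcd (ord z) k"
  proof -
    obtain a b where ab: "ord z = gcd (ord z) k * a" "ord z = gcd (ord z) l * b"
      by (metis dvdE gcd_dvd1)
    have pos: "gcd (ord z) k > 0" "gcd (ord z) l > 0"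
      using N by simp_all
    have "ord x = a" "ord y = b"
      unfolding k l o using ab pos
      by (metis nonzero_mult_div_cancel_left less_numeral_extra(3))+
    then obtain c where "b = a * c"
      using dvd by auto
    then have "gcd (ord z) k * a = gcd (ord z) l * c * a"
      using ab by (simp add: ac_simps)
    moreover have "a > 0" using ab N by (metis mult_0_right not_gr_zero)
    ultimately show ?thesis by simp
  qed
  then have "gcd (int (ord z)) (int l) dvd int k"
    by (metis dvd_trans gcd_dvd2 gcd_int_int_eq int_dvd_int_iff)
  then obtain m where m: "int k = gcd (int (ord z)) (int l) * m" by (rule dvdE)
  obtain a b where "a * int (ord z) + b * int l = gcd (int (ord z)) (int l)"
    using bezout_int by blast
  \<comment> \<open>The part of the exponent that is a multiple of \<open>ord z\<close> contributes
    \<one>, which leaves a power of \<open>y\<close>.\<close>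
  then have "int k = int (ord z) * (a * m) + int l * (b * m)"
    using m by (metis distrib_left mult.commute mult.left_commute)
  then have "z [^] int k = (z [^] int (ord z)) [^] (a * m) \<otimes> (z [^] int l) [^] (b * m)"
    using z by (simp add: int_pow_mult int_pow_pow)
  also have "\<dots> = (z [^] int l) [^] (b * m)"
    using z by (simp add: int_pow_int)
  finally have "x = y [^] (b * m)"
    by (simp add: int_pow_int k l)
  then show "x \<in> generate G {y}"
    using yc by (auto simp: generate_pow)
qed

lemma (in group) generate_singleton_commute:
  assumes z: "z \<in> carrier G" and "x \<in> generate G {z}" "y \<in> generate G {z}"
  shows "x \<otimes> y = y \<otimes> x"
  using assms by (auto simp: generate_pow int_pow_mult[symmetric] add.commute)

section \<open>Centralizers and products of commuting elements\<close>

definition (in group) centralizer :: "'a \<Rightarrow> 'a set" where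
  "centralizer x = {g \<in> carrier G. g \<otimes> x = x \<otimes> g}"

lemma (in group) subgroup_centralizer:
  assumes x: "x \<in> carrier G"
  shows "subgroup (centralizer x) G"
proof (rule subgroupI)
  show "centralizer x \<noteq> {}"
    using x by (auto simp: centralizer_def)
next
  fix g assume "g \<in> centralizer x"
  then have g: "g \<in> carrier G" "g \<otimes> x = x \<otimes> g" by (auto simp: centralizer_def)
  then have "x \<otimes> inv g = inv g \<otimes> x"
    using x by (metis inv_closed inv_solve_left m_assoc m_closed r_inv r_one)
  then show "inv g \<in> centralizer x"
    using g by (simp add: centralizer_def)
next
  fix g h assume "g \<in> centralizer x" "h \<in> centralizer x"
  then show "g \<otimes> h \<in> centralizer x"
    using x by (auto simp: centralizer_def) (metis m_assoc)
qed (auto simp: centralizer_def)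

text \<open>Lagrange's theorem is applied inside the centralizer, which contains the cyclic subgroup
  of \<open>y\<close>.\<close>

lemma (in group) ord_dvd_card_centralizer:
  assumes "x \<in> carrier G" "y \<in> carrier G" "y \<otimes> x = x \<otimes> y"
  shows "ord y dvd card (centralizer x)"
proof -
  let ?C = "G\<lparr>carrier := centralizer x\<rparr>"
  have C: "subgroup (centralizer x) G"
    using assms(1) by (rule subgroup_centralizer)
  interpret C: group ?C
    using C by (rule subgroup_imp_group)
  have y: "y \<in> centralizer x"
    using assms by (simp add: centralizer_def)
  have "subgroup (generate G {y}) ?C"
    using y C assms(2) by (intro subgroup_incl generate_is_subgroup generate_subgroup_incl) auto
  then have "card (generate G {y}) dvd order ?C"
    by (rule C.lagrange[THEN subst]) (rule dvd_triv_right)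
  then show ?thesis
    by (simp add: order_def generate_pow_card[OF assms(2)])
qed

text \<open>The exponent \<open>ord (a \<otimes> b) * ord a\<close> kills both the product and
  \<open>a\<close>, hence also \<open>b\<close>; coprimality then removes the factor
  \<open>ord a\<close>.\<close>

lemma (in group) ord_mult_coprime:
  assumes xy: "x \<in> carrier G" "y \<in> carrier G" "x \<otimes> y = y \<otimes> x" and "coprime (ord x) (ord y)"
  shows "ord (x \<otimes> y) = ord x * ord y"
proof (rule dvd_antisym)
  show "ord (x \<otimes> y) dvd ord x * ord y"
    using xy by (intro ord_mul_divides) auto
  have *: "ord b dvd ord (a \<otimes> b)"
    if "a \<in> carrier G" "b \<in> carrier G" "a \<otimes> b = b \<otimes> a" "coprime (ord a) (ord b)" for a b
  proof -
    let ?n = "ord (a \<otimes> b) * ord a"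
    have "\<one> = (a \<otimes> b) [^] ?n"
      using that pow_eq_id[of "a \<otimes> b" ?n] by simp
    also have "\<dots> = a [^] ?n \<otimes> b [^] ?n"
      using that by (intro pow_mult_distrib)
    also have "a [^] ?n = \<one>"
      using that by (simp add: pow_eq_id)
    finally have "b [^] ?n = \<one>"
      using that by simp
    then have "ord b dvd ?n"
      using that pow_eq_id by blast
    then show ?thesis
      using that(4) by (simp add: coprime_commute coprime_dvd_mult_left_iff)
  qed
  have "ord y dvd ord (x \<otimes> y)" "ord x dvd ord (x \<otimes> y)"
    using *[of x y] *[of y x] assms by (simp_all add: coprime_commute)
  then show "ord x * ord y dvd ord (x \<otimes> y)"
    using assms by (intro divides_mult) auto
qed

lemma (in group) exists_ord_dvd_of_commute:
  fixes p :: nat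
  assumes fin: "finite (carrier G)" and xy: "x \<in> carrier G" "y \<in> carrier G" "x \<otimes> y = y \<otimes> x"
    and p: "prime p" "p dvd ord x" and m: "m dvd ord y" "coprime p m"
  obtains z where "z \<in> carrier G" "p * m dvd ord z"
proof (cases "p dvd ord y")
  case True
  then have "p * m dvd ord y"
    using m by (intro divides_mult)
  then show ?thesis using that xy by blast
next
  case False
  have pos: "ord x > 0" using ord_ge_1[OF fin xy(1)] by simp
  \<comment> \<open>This power of \<open>x\<close> has order exactly \<open>p\<close>, hence coprime
    to \<open>ord y\<close>, which may fail for \<open>x\<close> itself.\<close>
  define w where "w = x [^] (ord x div p)"
  have w: "w \<in> carrier G" using xy by (simp add: w_def)
  have "ord x div p dvd ord x" "ord x div p \<noteq> 0"
    using pos p by (auto simp: dvd_div_eq_0_iff)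
  then have "ord w = ord x div (ord x div p)"
    unfolding w_def using xy by (intro ord_pow) 
  also have "\<dots> = p"
    using pos p by (auto elim!: dvdE)
  finally have ow: "ord w = p" .
  have "w \<otimes> y = y \<otimes> w"
    unfolding w_def using xy by (simp add: group_commutes_pow)
  then have "ord (w \<otimes> y) = p * ord y"
    using ord_mult_coprime[OF w xy(2)] False p ow by (simp add: prime_imp_coprime)
  then show ?thesis
    using that[of "w \<otimes> y"] w xy m by simp
qed

text \<open>The centralizer of \<open>x\<close> has order divisible by all three primes, so it is
  the whole group. Thus \<open>x\<close> commutes with \<open>z\<close>, and the prime
  \<open>r\<close> from \<open>x\<close> combines with \<open>p * q\<close> from
  \<open>z\<close>.\<close>

lemma (in group) exists_ord_dvd_of_star:
  fixes p q r :: nat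
  assumes fin: "finite (carrier G)" and order: "order G = p * q * r"
    and primes: "prime p" "prime q" "prime r" and distinct: "p \<noteq> q" "p \<noteq> r" "q \<noteq> r"
    and x: "x \<in> carrier G" "r dvd ord x"
    and u: "u \<in> carrier G" "p dvd ord u" "u \<otimes> x = x \<otimes> u"
    and v: "v \<in> carrier G" "q dvd ord v" "v \<otimes> x = x \<otimes> v"
    and z: "z \<in> carrier G" "p dvd ord z" "q dvd ord z"
  shows "\<exists>w \<in> carrier G. p * q * r dvd ord w"
proof -
  have cop: "coprime p q" "coprime p r" "coprime q r"
    using primes distinct by (simp_all add: primes_coprime)
  have "p dvd card (centralizer x)" "q dvd card (centralizer x)" "r dvd card (centralizer x)"
    using ord_dvd_card_centralizer[of x] x u v by (blast intro: dvd_trans)+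
  then have "order G dvd card (centralizer x)"
    unfolding order using cop by (intro divides_mult) auto
  moreover have sub: "centralizer x \<subseteq> carrier G"
    by (auto simp: centralizer_def)
  moreover have "card (centralizer x) > 0"
    using subgroup.finite_imp_card_positive[OF subgroup_centralizer[OF x(1)] fin] .
  ultimately have "centralizer x = carrier G"
    using fin unfolding order_def by (intro card_seteq) (auto dest: dvd_imp_le)
  then have "z \<in> centralizer x"
    using z by simp
  then have "x \<otimes> z = z \<otimes> x"
    by (simp add: centralizer_def)
  then obtain w where "w \<in> carrier G" "r * (p * q) dvd ord w"
    using exists_ord_dvd_of_commute[OF fin x(1) z(1) _ primes(3) x(2), of "p * q"] z cop
    by (auto simp: divides_mult coprime_commute)
  then show ?thesis
    by (auto simp: mult.commute)
qed

section \<open>Divisors\<close>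

text \<open>Powers of \<open>p\<close> form a chain under divisibility. A common factor
  \<open>q\<close> is cancelled; otherwise both numbers are coprime to \<open>q\<close> and already
  divide \<open>p ^ k\<close>.\<close>

lemma dvd_linear_of_dvd_prime_power_mult:
  fixes p q :: nat
  assumes p: "prime p" and q: "prime q"
    and a: "a dvd p ^ k * q" and b: "b dvd p ^ k * q" and iff: "q dvd a \<longleftrightarrow> q dvd b"
  shows "a dvd b \<or> b dvd a"
proof -
  have linear: "c dvd d \<or> d dvd c" if cd: "c dvd p ^ k" "d dvd p ^ k" for c d
  proof -
    obtain i j where "c = p ^ i" "d = p ^ j"
      using cd unfolding divides_primepow_nat[OF p] by blast
    then show ?thesis
      by (metis le_imp_power_dvd nat_le_linear)
  qed
  show ?thesis
  proof (cases "q dvd a")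
    case True
    then obtain a' b' where "a = q * a'" "b = q * b'"
      using iff by (auto elim!: dvdE)
    moreover from this have "a' dvd p ^ k" "b' dvd p ^ k"
      using a b q by (simp_all add: mult.commute prime_gt_0_nat)
    ultimately show ?thesis
      using linear by auto
  next
    case False
    then have "coprime a q" "coprime b q"
      using q iff prime_imp_coprime[of q] by (simp_all add: coprime_commute)
    then show ?thesis
      using a b by (intro linear) (simp_all add: coprime_dvd_mult_left_iff)
  qed
qed

text \<open>As a divisor of a product of distinct primes, \<open>a\<close> is the product of the
  primes dividing it.\<close>

lemma dvd_iff_of_dvd_prod3:
  fixes p q r :: nat
  assumes primes: "prime p" "prime q" "prime r" and distinct: "p \<noteq> q" "p \<noteq> r" "q \<noteq> r"
    and a: "a dvd p * q * r"
  shows "a dvd b \<longleftrightarrow> (p dvd a \<longrightarrow> p dvd b) \<and> (q dvd a \<longrightarrow> q dvd b) \<and> (r dvd a \<longrightarrow> r dvd b)"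
proof
  assume *: "(p dvd a \<longrightarrow> p dvd b) \<and> (q dvd a \<longrightarrow> q dvd b) \<and> (r dvd a \<longrightarrow> r dvd b)"
  obtain p' q' r' where a_eq: "a = p' * q' * r'" and dvd: "p' dvd p" "q' dvd q" "r' dvd r"
    using a by (metis division_decomp)
  have factor: "s' dvd b" if "prime s" "s' dvd s" "s' dvd a" "s dvd a \<longrightarrow> s dvd b" for s s'
    using that by (metis one_dvd prime_nat_iff)
  have "p' dvd b" "q' dvd b" "r' dvd b"
    using factor[OF primes(1) dvd(1)] factor[OF primes(2) dvd(2)] factor[OF primes(3) dvd(3)] *
    by (simp_all add: a_eq)
  moreover have cop: "coprime p q" "coprime (p * q) r"
    using primes distinct by (simp_all add: primes_coprime)
  have "coprime p' q'"
    using dvd(1,2) cop(1) by (rule coprime_divisors)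
  moreover have "coprime (p' * q') r'"
    using mult_dvd_mono[OF dvd(1,2)] dvd(3) cop(2) by (rule coprime_divisors)
  ultimately show "a dvd b"
    unfolding a_eq by (intro divides_mult)
qed (auto intro: dvd_trans)

section \<open>The difference graph\<close>

text \<open>Inside a common cyclic subgroup, membership in generated subgroups is divisibility of
  orders. Incomparable orders also force \<open>x \<noteq> y\<close>.\<close>

lemma (in group) arc_difference_graph_iff:
  assumes fin: "finite (carrier G)"
  shows "(x, y) \<in> parcs (difference_graph G) \<longleftrightarrow>
    x \<in> carrier G \<and> y \<in> carrier G \<and>
    (\<exists>z \<in> carrier G. x \<in> generate G {z} \<and> y \<in> generate G {z}) \<and>
    \<not> ord x dvd ord y \<and> \<not> ord y dvd ord x"
proof -
  have "(x, y) \<in> parcs (difference_graph G) \<longleftrightarrow>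
    x \<in> carrier G \<and> y \<in> carrier G \<and> x \<noteq> y \<and> cyclic_group (subgroup_generated G {x, y}) \<and>
    x \<notin> generate G {y} \<and> y \<notin> generate G {x}"
    by (auto simp: difference_graph_def remove_isolated_def delete_edges_def
        enhanced_power_graph_def power_graph_def)
  also have "\<dots> \<longleftrightarrow> x \<in> carrier G \<and> y \<in> carrier G \<and>
    (\<exists>z \<in> carrier G. x \<in> generate G {z} \<and> y \<in> generate G {z}) \<and>
    \<not> ord x dvd ord y \<and> \<not> ord y dvd ord x"
    (is "?L \<longleftrightarrow> ?R")
  proof
    assume ?L
    then obtain z where "z \<in> carrier G" "x \<in> generate G {z}" "y \<in> generate G {z}"
      using cyclic_subgroup_generated_pair_iff by blast
    with \<open>?L\<close> show ?R
      using in_generate_iff_ord_dvd[OF fin] by blast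
  next
    assume ?R
    then obtain z where z: "z \<in> carrier G" "x \<in> generate G {z}" "y \<in> generate G {z}"
      and xy: "x \<in> carrier G" "y \<in> carrier G" and ord: "\<not> ord x dvd ord y" "\<not> ord y dvd ord x"
      by blast
    have "cyclic_group (subgroup_generated G {x, y})"
      unfolding cyclic_subgroup_generated_pair_iff[OF xy] using z by blast
    then show ?L
      using xy ord in_generate_iff_ord_dvd[OF fin z] in_generate_iff_ord_dvd[OF fin z(1,3,2)]
      by auto
  qed
  finally show ?thesis .
qed

lemma (in group) verts_difference_graph:
  "pverts (difference_graph G) \<subseteq> carrier G"
  by (auto simp: difference_graph_def remove_isolated_def delete_edges_def enhanced_power_graph_def)

lemma (in group) graph_difference_graph:
  assumes fin: "finite (carrier G)"
  shows "graph (with_proj (difference_graph G))"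
proof -
  let ?D = "difference_graph G"
  have verts: "fst e \<in> pverts ?D \<and> snd e \<in> pverts ?D" if "e \<in> parcs ?D" for e
    using that by (cases e) (auto simp: difference_graph_def remove_isolated_def delete_edges_def
        enhanced_power_graph_def)
  have finv: "finite (pverts ?D)"
    using verts_difference_graph fin by (rule finite_subset)
  have "parcs ?D \<subseteq> pverts ?D \<times> pverts ?D"
    using verts by (auto simp: mem_Times_iff)
  then have "finite (parcs ?D)"
    using finv by (meson finite_SigmaI finite_subset)
  moreover have "fst e \<noteq> snd e" if "e \<in> parcs ?D" for e
    using that arc_difference_graph_iff[OF fin] by (cases e) auto
  moreover have "sym (parcs ?D)"
    by (auto intro!: symI simp: arc_difference_graph_iff[OF fin])
  ultimately show ?thesis
    using verts finv by unfold_locales (auto simp: arc_to_ends_def symmetric_def prod_eq_iff)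
qed

text \<open>If some vertex of one class has neighbours in both other classes, that class meets every
  edge. Otherwise every vertex has neighbours in at most one other class, and the edges between
  two classes form a component of their own.\<close>

lemma incomparable3_bipartite:
  assumes sym: "\<And>u v. E u v \<Longrightarrow> E v u"
    and inc: "\<And>u v. E u v \<Longrightarrow> incomparable3 P Q R u v"
    and not_all: "\<And>u v. E u v \<Longrightarrow> \<not> ((P u \<or> P v) \<and> (Q u \<or> Q v) \<and> (R u \<or> R v))"
    and starP: "\<And>x u v a b. \<lbrakk>E x u; E x v; P x; Q u; R v; E a b; Q a; R b\<rbrakk> \<Longrightarrow> False"
    and starQ: "\<And>x u v a b. \<lbrakk>E x u; E x v; Q x; P u; R v; E a b; P a; R b\<rbrakk> \<Longrightarrow> False"
    and starR: "\<And>x u v a b. \<lbrakk>E x u; E x v; R x; P u; Q v; E a b; P a; Q b\<rbrakk> \<Longrightarrow> False"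
  obtains c :: "'a \<Rightarrow> bool" where "\<And>u v. E u v \<Longrightarrow> c u \<noteq> c v"
proof -
  \<comment> \<open>Two incomparable sets whose union is not everything are distinct
    singletons.\<close>
  have edge: "P u \<and> \<not> Q u \<and> \<not> R u \<and> \<not> P v \<and> Q v \<and> \<not> R v \<or>
      P u \<and> \<not> Q u \<and> \<not> R u \<and> \<not> P v \<and> \<not> Q v \<and> R v \<or>
      \<not> P u \<and> Q u \<and> \<not> R u \<and> P v \<and> \<not> Q v \<and> \<not> R v \<or>
      \<not> P u \<and> Q u \<and> \<not> R u \<and> \<not> P v \<and> \<not> Q v \<and> R v \<or>
      \<not> P u \<and> \<not> Q u \<and> R u \<and> P v \<and> \<not> Q v \<and> \<not> R v \<or>
      \<not> P u \<and> \<not> Q u \<and> R u \<and> \<not> P v \<and> Q v \<and> \<not> R v" if "E u v" for u v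
    using inc[OF that] not_all[OF that] unfolding incomparable3_def by argo
  show ?thesis
  proof (cases "\<exists>x u v. E x u \<and> E x v \<and>
      (P x \<and> Q u \<and> R v \<or> Q x \<and> P u \<and> R v \<or> R x \<and> P u \<and> Q v)")
    case True
    \<comment> \<open>The class of the centre \<open>x\<close> meets every edge, since the star
      hypothesis excludes edges between the other two; it serves as a colour class.\<close>
    then consider "\<And>a b. \<lbrakk>E a b; Q a; R b\<rbrakk> \<Longrightarrow> False" | "\<And>a b. \<lbrakk>E a b; P a; R b\<rbrakk> \<Longrightarrow> False"
      | "\<And>a b. \<lbrakk>E a b; P a; Q b\<rbrakk> \<Longrightarrow> False"
      using starP starQ starR by metis
    then show ?thesis
    proof cases
      case 1
      show ?thesis by (rule that[of P]) (use edge sym 1 in metis)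
    next
      case 2
      show ?thesis by (rule that[of Q]) (use edge sym 2 in metis)
    next
      case 3
      show ?thesis by (rule that[of R]) (use edge sym 3 in metis)
    qed
  next
    case False
    show ?thesis
    proof (rule that)
      fix u v assume uv: "E u v"
      \<comment> \<open>Class \<open>R\<close> is true and class \<open>P\<close> is false. A
        \<open>Q\<close> vertex with a neighbour in \<open>P\<close> has none in \<open>R\<close>,
        so it can be true; the other \<open>Q\<close> vertices are false.\<close>
      let ?c = "\<lambda>u. R u \<or> Q u \<and> (\<exists>w. E u w \<and> P w)"
      from edge[OF uv] show "?c u \<noteq> ?c v"
        using uv sym[OF uv] False by metis
    qed
  qed
qed

section \<open>Perfectness for each form of the group order\<close>

lemma (in group) perfect_difference_graph_prime_power_mult:
  fixes p q :: nat
  assumes "prime p" "prime q" and order: "order G = p ^ k * q"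
  shows "perfect_graph (with_proj (difference_graph G))"
proof -
  have fin: "finite (carrier G)"
    using assms by (metis order_gt_0_iff_finite mult_pos_pos prime_gt_0_nat zero_less_power)
  show ?thesis
  proof (rule perfect_graph_bipartite[where c = "\<lambda>x. q dvd ord x"])
    fix x y assume "(x, y) \<in> arcs_ends (with_proj (difference_graph G))"
    then show "(q dvd ord x) \<noteq> (q dvd ord y)"
      using dvd_linear_of_dvd_prime_power_mult[OF assms(1,2), of "ord x" k "ord y"]
        ord_dvd_group_order[of x] ord_dvd_group_order[of y]
      by (auto simp: arc_difference_graph_iff[OF fin] order)
  qed (rule graph_difference_graph[OF fin])
qed

lemma (in group) perfect_difference_graph_prod3:
  fixes p q r :: nat
  assumes primes: "prime p" "prime q" "prime r" and distinct: "p \<noteq> q" "p \<noteq> r" "q \<noteq> r"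
    and order: "order G = p * q * r"
  shows "perfect_graph (with_proj (difference_graph G))"
proof -
  let ?D = "with_proj (difference_graph G)"
  let ?P = "\<lambda>x. p dvd ord x" and ?Q = "\<lambda>x. q dvd ord x" and ?R = "\<lambda>x. r dvd ord x"
  have fin: "finite (carrier G)"
    using primes order by (metis order_gt_0_iff_finite mult_pos_pos prime_gt_0_nat)
  note graph = graph_difference_graph[OF fin]
  have inc: "\<not> ord x dvd ord y \<and> \<not> ord y dvd ord x \<longleftrightarrow> incomparable3 ?P ?Q ?R x y"
    if "x \<in> carrier G" "y \<in> carrier G" for x y
  proof -
    have "ord x dvd p * q * r" "ord y dvd p * q * r"
      using that ord_dvd_group_order order by metis+
    then show ?thesis
      unfolding incomparable3_def using dvd_iff_of_dvd_prod3[OF primes distinct] by blast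
  qed
  show ?thesis
  \<comment> \<open>Such a \<open>w\<close> exists exactly when the group is cyclic.\<close>
  proof (cases "\<exists>w \<in> carrier G. p * q * r dvd ord w")
    case True
    then obtain w where w: "w \<in> carrier G" "order G dvd ord w"
      using order by auto
    have "order G \<le> card (generate G {w})"
      using w ord_ge_1[OF fin w(1)] by (simp add: dvd_imp_le generate_pow_card[symmetric])
    then have gen: "generate G {w} = carrier G"
      using w fin generate_incl[of "{w}"] by (intro card_seteq) (auto simp: order_def)
    show ?thesis
    proof (rule perfect_graphI[OF graph])
      fix Y :: "('a, 'a \<times> 'a) pre_digraph"
      assume Y: "graph Y" "verts Y \<subseteq> verts ?D"
        "\<And>u v. (u, v) \<in> arcs_ends Y \<longleftrightarrow> (u, v) \<in> arcs_ends ?D \<and> u \<in> verts Y \<and> v \<in> verts Y"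
      have "verts Y \<subseteq> carrier G"
        using Y(2) verts_difference_graph by auto
      \<comment> \<open>The generator \<open>w\<close> puts every pair into a common cyclic
        subgroup, so only incomparability of orders remains of adjacency.\<close>
      moreover have "\<exists>z \<in> carrier G. u \<in> generate G {z} \<and> v \<in> generate G {z}"
        if "u \<in> carrier G" "v \<in> carrier G" for u v
        using that w(1) gen by blast
      ultimately have "(u, v) \<in> arcs_ends Y \<longleftrightarrow> u \<in> verts Y \<and> v \<in> verts Y \<and> incomparable3 ?P ?Q ?R u v" for u v
        using Y(3)[of u v] inc[of u v] unfolding with_proj_simps arc_difference_graph_iff[OF fin]
        by blast
      then show "chromatic_number Y = clique_number Y"
        by (rule chromatic_eq_clique_incomparable3[OF Y(1)])
    qed
  next
    case False
    define E where "E x y \<longleftrightarrow> (x, y) \<in> parcs (difference_graph G)" for x y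
    have E: "x \<in> carrier G" "y \<in> carrier G" "y \<otimes> x = x \<otimes> y" "incomparable3 ?P ?Q ?R x y"
      "\<exists>z \<in> carrier G. ord x dvd ord z \<and> ord y dvd ord z" if "E x y" for x y
    proof -
      from that obtain z where z: "x \<in> carrier G" "y \<in> carrier G" "z \<in> carrier G"
        "x \<in> generate G {z}" "y \<in> generate G {z}" "\<not> ord x dvd ord y \<and> \<not> ord y dvd ord x"
        by (auto simp: E_def arc_difference_graph_iff[OF fin])
      then show "x \<in> carrier G" "y \<in> carrier G" "y \<otimes> x = x \<otimes> y" "incomparable3 ?P ?Q ?R x y"
        using generate_singleton_commute inc by blast+
      show "\<exists>z \<in> carrier G. ord x dvd ord z \<and> ord y dvd ord z"
        using z ord_dvd_ord_if_in_generate by blast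
    qed
    have cop: "coprime p q" "coprime (p * q) r"
      using primes distinct by (simp_all add: primes_coprime)
    have not_all: "\<not> ((?P x \<or> ?P y) \<and> (?Q x \<or> ?Q y) \<and> (?R x \<or> ?R y))" if xy: "E x y" for x y
    proof
      assume all: "(?P x \<or> ?P y) \<and> (?Q x \<or> ?Q y) \<and> (?R x \<or> ?R y)"
      obtain z where z: "z \<in> carrier G" "ord x dvd ord z" "ord y dvd ord z"
        using E(5)[OF xy] by blast
      then have "p dvd ord z" "q dvd ord z" "r dvd ord z"
        using all by (meson dvd_trans)+
      then have "p * q * r dvd ord z"
        using cop by (intro divides_mult)
      then show False using False z by blast
    qed
    \<comment> \<open>Adjacent elements commute, so \<open>u\<close> and \<open>v\<close> centralize
      \<open>x\<close>, while the edge from \<open>a\<close> to \<open>b\<close> yields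
      \<open>z\<close> of order divisible by \<open>p'\<close> and \<open>q'\<close>. The primed
      names let any of the three primes belong to the centre.\<close>
    have star: False
      if E': "E x u" "E x v" "E a b" and dvd: "r' dvd ord x" "p' dvd ord u" "q' dvd ord v" "p' dvd ord a" "q' dvd ord b"
        and perm: "p' * q' * r' = p * q * r" "prime p'" "prime q'" "prime r'" "p' \<noteq> q'" "p' \<noteq> r'" "q' \<noteq> r'"
      for x u v a b p' q' r'
    proof -
      obtain z where z: "z \<in> carrier G" "p' dvd ord z" "q' dvd ord z"
        using E(5)[OF E'(3)] dvd(4,5) by (meson dvd_trans)
      have "\<exists>w \<in> carrier G. p' * q' * r' dvd ord w"
        using perm order E[OF E'(1)] E[OF E'(2)] dvd z
        by (intro exists_ord_dvd_of_star[OF fin, of p' q' r' x u v z]) simp_all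
      then show False
        using False perm by simp
    qed
    obtain c :: "'a \<Rightarrow> bool" where c: "\<And>u v. E u v \<Longrightarrow> c u \<noteq> c v"
    proof (rule incomparable3_bipartite[of E ?P ?Q ?R])
      show "E v u" if "E u v" for u v
        using that by (auto simp: E_def arc_difference_graph_iff[OF fin])
      show False if "E x u" "E x v" "?P x" "?Q u" "?R v" "E a b" "?Q a" "?R b" for x u v a b
        using star[of x u v a b p q r] that primes distinct by (simp add: ac_simps)
      show False if "E x u" "E x v" "?Q x" "?P u" "?R v" "E a b" "?P a" "?R b" for x u v a b
        using star[of x u v a b q p r] that primes distinct by (simp add: ac_simps)
      show False if "E x u" "E x v" "?R x" "?P u" "?Q v" "E a b" "?P a" "?Q b" for x u v a b
        using star[of x u v a b r p q] that primes distinct by simp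
    qed (use E(4) not_all in blast)+
    then show ?thesis
      by (intro perfect_graph_bipartite[OF graph, of c]) (simp add: E_def)
  qed
qed

theorem theorem7p2:
  fixes G :: "('a, 'b) monoid_scheme" and p q r :: nat
  assumes "group G"
    and "prime p" and "prime q" and "prime r"
    and "p \<noteq> q" and "p \<noteq> r" and "q \<noteq> r"
    and "order G = p * q \<or> order G = p\<^sup>2 * q \<or> order G = p * q * r"
  shows "perfect_graph (with_proj (difference_graph G))"
proof -
  interpret group G by fact
  \<comment> \<open>Writing \<open>p\<close> as \<open>p ^ 1\<close> lets one lemma cover the first
    two orders.\<close>
  from assms(8) consider "order G = p ^ 1 * q" | "order G = p\<^sup>2 * q" | "order G = p * q * r"
    by auto
  then show ?thesis
    using assms perfect_difference_graph_prime_power_mult perfect_difference_graph_prod3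
    by cases blast+
qed

end
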